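(* There exists an absolute constant $c>0$ such that for all $m,n\in\mathbb{N}$, with $N=mn$, and all $p_1,p_2,q_1,q_2\in[1,\infty]$ with $p_1\le q_1\le 2$ and $p_2\ge q_2$, $$c\,m^{1/q_2-1/p_2}\le d_{\lfloor N/2\rfloor}\bigl(B_{p_1,p_2}^{n,m},\ell_{q_1,q_2}^{n,m}\bigr)\le m^{1/q_2-1/p_2}.$$
   Context: Let $N=mn$. The coordinate set $\{1,\ldots,N\}$ is split into $m$ blocks $\Delta_s=\{(s-1)n+1,\ldots,sn\}$, $s=1,\ldots,m$, each of cardinality $n$. For $x\in\mathbb{R}^N$, let $x[s]=(x(i))_{i\in\Delta_s}\in\mathbb{R}^n$ be its restriction to the $s$-th block. For $1\le p,q\le\infty$ the mixed norm on $\mathbb{R}^N$ is $$\|x\|_{\ell_{p,q}^{n,m}}=\|y\|_{\ell_q^m},\quad y=(\|x[s]\|_{\ell_p^n})_{s=1}^m,$$ where $\|\cdot\|_{\ell_p^k}$ is the usual $\ell_p$ norm on $\mathbb{R}^k$. The space $\ell_{p,q}^{n,m}$ is $\mathbb{R}^N$ with this norm, and $B_{p,q}^{n,m}$ is its closed unit ball. By convention $1/\infty=0$. The Kolmogorov width of a subset $M$ of a normed space $X$ is $$d_k(M,X)=\inf_{\substack{L\subset X\\ \dim L\le k}}\ \sup_{x\in M}\ \inf_{y\in L}\|x-y\|_X,$$ where $L$ ranges over linear subspaces of $X$. *)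

theory Defs
  imports "HOL-Analysis.Analysis" "HOL-Library.Function_Algebras"
begin

text \<open>
  The dimension \<open>N = m * n\<close> has to be quantified inside the theorem (the constant must not depend
  on it), so vectors of \<open>\<real>\<^sup>N\<close> are functions on the naturals that vanish outside \<open>{1..N}\<close>.
  The pointwise vector space structure on functions makes the library notions \<open>subspace\<close>,
  \<open>span\<close> and \<open>dim\<close> applicable to them.
\<close>

instantiation "fun" :: (type, real_vector) real_vector
begin

definition scaleR_fun :: "real \<Rightarrow> ('a \<Rightarrow> 'b) \<Rightarrow> 'a \<Rightarrow> 'b" where
  "scaleR_fun a f = (\<lambda>x. a *\<^sub>R f x)"

instance
  by standard (auto simp: scaleR_fun_def fun_eq_iff scaleR_add_right scaleR_add_left)

end

definition Rvec :: "nat \<Rightarrow> (nat \<Rightarrow> real) set" where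
  "Rvec N = {x. \<forall>i. i \<notin> {1..N} \<longrightarrow> x i = 0}"

text \<open>The \<open>\<ell>\<^sub>p\<close> norm of the family \<open>(x i)\<close>, \<open>i \<in> I\<close>, for a finite nonempty index set \<open>I\<close> and
  \<open>1 \<le> p \<le> \<infinity>\<close>.\<close>

definition lp_norm :: "ereal \<Rightarrow> nat set \<Rightarrow> (nat \<Rightarrow> real) \<Rightarrow> real" where
  "lp_norm p I x =
     (if p = \<infinity> then Max ((\<lambda>i. \<bar>x i\<bar>) ` I)
      else (\<Sum>i\<in>I. \<bar>x i\<bar> powr real_of_ereal p) powr (1 / real_of_ereal p))"

definition block :: "nat \<Rightarrow> nat \<Rightarrow> nat set" where
  "block n s = {(s - 1) * n + 1..s * n}"

definition mixed_norm :: "nat \<Rightarrow> nat \<Rightarrow> ereal \<Rightarrow> ereal \<Rightarrow> (nat \<Rightarrow> real) \<Rightarrow> real" where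
  "mixed_norm n m p q x = lp_norm q {1..m} (\<lambda>s. lp_norm p (block n s) x)"

definition mixed_ball :: "nat \<Rightarrow> nat \<Rightarrow> ereal \<Rightarrow> ereal \<Rightarrow> (nat \<Rightarrow> real) set" where
  "mixed_ball n m p q = {x \<in> Rvec (m * n). mixed_norm n m p q x \<le> 1}"

text \<open>
  The Kolmogorov width of \<open>M\<close> in the normed space with carrier \<open>X\<close> and norm \<open>nrm\<close>, as an
  extended real (it is infinite if every supremum is).  Finite-dimensionality of \<open>L\<close> is
  required explicitly because \<open>dim L = 0\<close> when \<open>L\<close> is infinite-dimensional.
\<close>

definition kolmogorov_width ::
    "nat \<Rightarrow> 'a::real_vector set \<Rightarrow> 'a set \<Rightarrow> ('a \<Rightarrow> real) \<Rightarrow> ereal" where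
  "kolmogorov_width k M X nrm =
     (INF L \<in> {L. subspace L \<and> L \<subseteq> X \<and> (\<exists>B. finite B \<and> L = span B) \<and> dim L \<le> k}.
        SUP x\<in>M. INF y\<in>L. ereal (nrm (x - y)))"

end

theory Submission
  imports Defs
begin

text \<open>
  The upper bound is attained by \<open>L = {0}\<close>: the inner norm decreases in its exponent, and the outer
  one is compared by the power mean inequality.

  For the lower bound let \<open>E\<close> be the annihilator of \<open>L\<close> in \<open>\<real>\<^sup>N\<close>. It suffices to find \<open>y \<in> E\<close>,
  of Euclidean norm at most 1 on each block, and one coordinate \<open>i s\<close> in each block with
  \<open>\<Sum>\<^sub>s (y (i s))\<^sup>2 \<ge> m / 4608\<close>. Indeed, a multiple \<open>x\<close> of the sign vector of \<open>y\<close> on these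
  coordinates lies in the ball, \<open>\<langle>x - z, y\<rangle> = \<langle>x, y\<rangle>\<close> is large for all \<open>z \<in> L\<close>, and \<open>\<langle>w, y\<rangle>\<close> is
  at most \<open>\<Sum>\<^sub>s \<parallel>w[s]\<parallel>\<^sub>2\<close>.

  Such a \<open>y\<close> is a maximizer of \<open>exp (48 * \<Sum>\<^sub>s (y (i s))\<^sup>2) * \<Prod>\<^sub>s (1 - \<parallel>y[s]\<parallel>\<^sup>2)\<close> over \<open>E\<close>. Let \<open>F\<close>
  be the set of blocks with \<open>\<parallel>y[s]\<parallel>\<^sup>2 > 1/2\<close>. Comparison with \<open>y = 0\<close> bounds \<open>\<Sum>\<^sub>s (y (i s))\<^sup>2\<close>
  below by a multiple of \<open>card F\<close>. If \<open>card F\<close> were at most \<open>m / 48\<close>, then a second-order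
  variation along the projection of some unit vector \<open>e\<^bsub>i s\<^esub>\<close> onto
  \<open>{v \<in> E. v vanishes on the blocks in F}\<close> would increase the functional, provided that projection
  has norm bounded below. The choice of \<open>i\<close> guarantees this for all small \<open>F\<close> at once: by the trace
  of the projection a fixed fraction of all coordinates is good for any given \<open>F\<close>, so only an
  exponentially small fraction of the choices of \<open>i\<close> misses all of them, and there are
  too few small sets \<open>F\<close> to exhaust all choices.
\<close>

section \<open>Solutions of homogeneous linear systems\<close>

text \<open>Gaussian elimination: if \<open>a p\<close> is nonzero, subtracting multiples of
  \<open>a\<close> removes the unknown \<open>p\<close> from the other equations. This costs one
  equation and one unknown, and equations that merge under \<open>h\<close> only lower the count.
  The value at \<open>p\<close> is then fitted to \<open>a\<close>.\<close>

lemma homogeneous_system_nontrivial_solution: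
  fixes A :: "('a \<Rightarrow> real) set"
  assumes "finite A" "finite J" "card A < card J"
  obtains v where "v \<noteq> (\<lambda>_. 0)" "\<And>j. j \<notin> J \<Longrightarrow> v j = 0"
    "\<And>a. a \<in> A \<Longrightarrow> (\<Sum>j\<in>J. a j * v j) = 0"
proof -
  have "\<exists>v. v \<noteq> (\<lambda>_. 0) \<and> (\<forall>j. j \<notin> J \<longrightarrow> v j = 0) \<and> (\<forall>a\<in>A. (\<Sum>j\<in>J. a j * v j) = 0)"
    using assms
  proof (induction "card A" arbitrary: A J rule: less_induct)
    case less
    show ?case
    proof (cases "\<exists>a\<in>A. \<exists>p\<in>J. a p \<noteq> 0")
      case False
      obtain p where p: "p \<in> J"
        using less.prems by fastforce
      define v :: "'a \<Rightarrow> real" where "v j = (if j = p then 1 else 0)" for j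
      have "v p \<noteq> 0"
        by (simp add: v_def)
      then have "v \<noteq> (\<lambda>_. 0)"
        by metis
      moreover have "\<forall>j. j \<notin> J \<longrightarrow> v j = 0"
        using p by (auto simp: v_def)
      moreover have "\<forall>a\<in>A. (\<Sum>j\<in>J. a j * v j) = 0"
        using False by (auto intro!: sum.neutral)
      ultimately show ?thesis
        by blast
    next
      case True
      then obtain a p where a: "a \<in> A" and p: "p \<in> J" and ap: "a p \<noteq> 0"
        by blast
      define h where "h b = (\<lambda>j. b j - b p / a p * a j)" for b :: "'a \<Rightarrow> real"
      define A' where "A' = h ` (A - {a})"
      define J' where "J' = J - {p}"
      have le: "card A' \<le> card (A - {a})"
        unfolding A'_def using less.prems by (intro card_image_le) auto
      moreover have lt: "card (A - {a}) < card A"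
        using less.prems a by (intro psubset_card_mono) auto
      moreover have "card J = Suc (card J')"
        using p less.prems unfolding J'_def by (metis card.remove)
      moreover have "card A = Suc (card (A - {a}))"
        using a less.prems by (metis card.remove)
      ultimately have cards: "card A' < card A" "card A' < card J'"
        using less.prems by linarith+
      have "finite A'" "finite J'"
        using less.prems by (auto simp: A'_def J'_def)
      with less.hyps[of A' J'] cards obtain v where v: "v \<noteq> (\<lambda>_. 0)" "\<forall>j. j \<notin> J' \<longrightarrow> v j = 0"
        "\<forall>b\<in>A'. (\<Sum>j\<in>J'. b j * v j) = 0"
        by blast
      define w where "w = v(p := - (\<Sum>j\<in>J'. a j * v j) / a p)"
      obtain q where q: "v q \<noteq> 0"
        using v(1) by blast
      then have "q \<noteq> p"
        using v(2) by (auto simp: J'_def)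
      then have "w q \<noteq> 0"
        using q by (simp add: w_def)
      then have w0: "w \<noteq> (\<lambda>_. 0)"
        by metis
      have split: "(\<Sum>j\<in>J. b j * w j) = b p * w p + (\<Sum>j\<in>J'. b j * v j)" for b :: "'a \<Rightarrow> real"
      proof -
        have "(\<Sum>j\<in>J. b j * w j) = b p * w p + (\<Sum>j\<in>J'. b j * w j)"
          unfolding J'_def using p less.prems by (simp add: sum.remove)
        also have "(\<Sum>j\<in>J'. b j * w j) = (\<Sum>j\<in>J'. b j * v j)"
          by (intro sum.cong) (auto simp: w_def J'_def)
        finally show ?thesis .
      qed
      have ann: "(\<Sum>j\<in>J. b j * w j) = 0" if "b \<in> A" for b
      proof (cases "b = a")
        case True
        then show ?thesis
          unfolding split using ap by (simp add: w_def)
      next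
        case False
        then have "(\<Sum>j\<in>J'. h b j * v j) = 0"
          using v(3) that by (auto simp: A'_def)
        then have "(\<Sum>j\<in>J'. b j * v j) = b p / a p * (\<Sum>j\<in>J'. a j * v j)"
          by (simp add: h_def algebra_simps sum_subtractf sum_distrib_left)
        then show ?thesis
          unfolding split by (simp add: w_def)
      qed
      have "\<forall>j. j \<notin> J \<longrightarrow> w j = 0"
        using v(2) p by (auto simp: w_def J'_def)
      with w0 ann show ?thesis
        by blast
    qed
  qed
  with that show thesis
    by blast
qed

text \<open>The vectors already found are added to the equations, so the next solution is orthogonal
  to them; it exists as long as \<open>card A + d < card J\<close>.\<close>

lemma homogeneous_system_orthonormal_solutions:
  fixes A :: "('a \<Rightarrow> real) set"
  assumes "finite A" "finite J" "card A + d \<le> card J"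
  shows "\<exists>f :: nat \<Rightarrow> 'a \<Rightarrow> real.
    (\<forall>k<d. (\<forall>j. j \<notin> J \<longrightarrow> f k j = 0) \<and> (\<forall>a\<in>A. (\<Sum>j\<in>J. a j * f k j) = 0)) \<and>
    (\<forall>k<d. \<forall>l<d. (\<Sum>j\<in>J. f k j * f l j) = (if k = l then 1 else 0))"
  using assms(3)
proof (induction d)
  case 0
  show ?case by simp
next
  case (Suc d)
  then have "card A + d \<le> card J"
    by simp
  from Suc.IH[OF this] obtain f :: "nat \<Rightarrow> 'a \<Rightarrow> real" where
    f: "\<And>k j. k < d \<Longrightarrow> j \<notin> J \<Longrightarrow> f k j = 0"
       "\<And>k a. k < d \<Longrightarrow> a \<in> A \<Longrightarrow> (\<Sum>j\<in>J. a j * f k j) = 0"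
       "\<And>k l. k < d \<Longrightarrow> l < d \<Longrightarrow> (\<Sum>j\<in>J. f k j * f l j) = (if k = l then 1 else 0)"
    by blast
  have "card (A \<union> f ` {..<d}) \<le> card A + d"
    using card_Un_le[of A "f ` {..<d}"] card_image_le[of "{..<d}" f] by simp
  then obtain v where v: "v \<noteq> (\<lambda>_. 0)" "\<And>j. j \<notin> J \<Longrightarrow> v j = 0"
    "\<And>a. a \<in> A \<union> f ` {..<d} \<Longrightarrow> (\<Sum>j\<in>J. a j * v j) = 0"
    using homogeneous_system_nontrivial_solution[of "A \<union> f ` {..<d}" J] assms Suc.prems by auto
  define r where "r = (\<Sum>j\<in>J. (v j)\<^sup>2)"
  obtain q where q: "v q \<noteq> 0"
    using v(1) by blast
  then have "q \<in> J"
    using v(2) by blast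
  then have "(v q)\<^sup>2 \<le> r"
    unfolding r_def using assms(2) by (intro member_le_sum) auto
  then have r: "r > 0"
    using q by (smt (verit) zero_less_power2)
  define g where "g = f(d := (\<lambda>j. v j / sqrt r))"
  have gd: "g d = (\<lambda>j. v j / sqrt r)" and gk: "k < d \<Longrightarrow> g k = f k" for k
    by (auto simp: g_def)
  have self: "(\<Sum>j\<in>J. g d j * g d j) = 1"
  proof -
    have "(\<Sum>j\<in>J. g d j * g d j) = (\<Sum>j\<in>J. (v j)\<^sup>2) / r"
      unfolding gd sum_divide_distrib using r by (intro sum.cong) (auto simp: power2_eq_square)
    then show ?thesis
      using r by (simp add: r_def)
  qed
  have cross: "(\<Sum>j\<in>J. g k j * g d j) = 0" if "k < d" for k
  proof -
    have "(\<Sum>j\<in>J. g k j * g d j) = (\<Sum>j\<in>J. f k j * v j) / sqrt r"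
      unfolding gd gk[OF that] sum_divide_distrib by simp
    then show ?thesis
      using v(3)[of "f k"] that by simp
  qed
  then have cross': "(\<Sum>j\<in>J. g d j * g k j) = 0" if "k < d" for k
    using cross[OF that] by (metis (no_types, lifting) mult.commute sum.cong)
  have annd: "(\<Sum>j\<in>J. a j * g d j) = 0" if "a \<in> A" for a
  proof -
    have "(\<Sum>j\<in>J. a j * g d j) = (\<Sum>j\<in>J. a j * v j) / sqrt r"
      unfolding gd sum_divide_distrib by simp
    then show ?thesis
      using v(3)[of a] that by simp
  qed
  show ?case
    by (rule exI[of _ g])
      (use f self cross cross' annd v(2) in \<open>auto simp: less_Suc_eq gk gd\<close>)
qed

text \<open>The vectors \<open>v\<close> are the columns of the orthogonal projection onto the solution space; its
  diagonal sums to the dimension, and no diagonal entry exceeds 1.\<close>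

lemma many_large_projection_diagonal_entries:
  fixes A :: "('a \<Rightarrow> real) set" and \<theta> :: real
  assumes "finite A" "finite J" "\<theta> \<ge> 0"
  obtains G where "G \<subseteq> J" "real (card G) \<ge> (1 - \<theta>) * card J - card A"
    "\<And>j. j \<in> G \<Longrightarrow> \<exists>v. (\<forall>i. i \<notin> J \<longrightarrow> v i = 0) \<and> (\<forall>a\<in>A. (\<Sum>i\<in>J. a i * v i) = 0) \<and>
        v j = (\<Sum>i\<in>J. (v i)\<^sup>2) \<and> \<theta> \<le> v j \<and> v j \<le> 1"
proof (cases "card A \<le> card J")
  case False
  have "0 \<le> \<theta> * real (card J)"
    using assms(3) by simp
  with False have "(1 - \<theta>) * card J - card A \<le> 0"
    unfolding left_diff_distrib by linarith
  then show ?thesis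
    using that[of "{}"] by auto
next
  case True
  define d where "d = card J - card A"
  have "card A + d \<le> card J"
    using True by (simp add: d_def)
  from homogeneous_system_orthonormal_solutions[OF assms(1,2) this]
  obtain f :: "nat \<Rightarrow> 'a \<Rightarrow> real" where
    f: "\<And>k j. k < d \<Longrightarrow> j \<notin> J \<Longrightarrow> f k j = 0"
       "\<And>k a. k < d \<Longrightarrow> a \<in> A \<Longrightarrow> (\<Sum>j\<in>J. a j * f k j) = 0"
       "\<And>k l. k < d \<Longrightarrow> l < d \<Longrightarrow> (\<Sum>j\<in>J. f k j * f l j) = (if k = l then 1 else 0)"
    by blast
  define P where "P j = (\<lambda>i. \<Sum>k<d. f k j * f k i)" for j
  have supp: "P j i = 0" if "i \<notin> J" for i j
    using f(1) that by (simp add: P_def)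
  have ann: "(\<Sum>i\<in>J. a i * P j i) = 0" if "a \<in> A" for a j
  proof -
    have "(\<Sum>i\<in>J. a i * P j i) = (\<Sum>k<d. f k j * (\<Sum>i\<in>J. a i * f k i))"
      unfolding P_def sum_distrib_left by (subst sum.swap) (simp add: mult_ac)
    then show ?thesis
      using f(2) that by simp
  qed
  \<comment> \<open>Orthonormality of \<open>f\<close> makes the symmetric matrix \<open>P\<close>
    idempotent, so the squared norm of column \<open>j\<close> is its diagonal entry.\<close>
  have idem: "(\<Sum>i\<in>J. (P j i)\<^sup>2) = P j j" for j
  proof -
    have "(\<Sum>i\<in>J. (P j i)\<^sup>2) = (\<Sum>i\<in>J. \<Sum>k<d. \<Sum>l<d. f k j * f l j * (f k i * f l i))"
      unfolding P_def power2_eq_square sum_product by (simp add: mult_ac)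
    also have "\<dots> = (\<Sum>k<d. \<Sum>i\<in>J. \<Sum>l<d. f k j * f l j * (f k i * f l i))"
      by (rule sum.swap)
    also have "\<dots> = (\<Sum>k<d. \<Sum>l<d. \<Sum>i\<in>J. f k j * f l j * (f k i * f l i))"
      by (intro sum.cong refl sum.swap)
    also have "\<dots> = (\<Sum>k<d. \<Sum>l<d. f k j * f l j * (if k = l then 1 else 0))"
      unfolding sum_distrib_left[symmetric] using f(3) by simp
    also have "\<dots> = P j j"
      by (simp add: P_def if_distrib cong: if_cong)
    finally show ?thesis .
  qed
  have le1: "P j j \<le> 1" if "j \<in> J" for j
  proof -
    have "(P j j)\<^sup>2 \<le> P j j"
      unfolding idem[of j, symmetric]
      using member_le_sum[of j J "\<lambda>i. (P j i)\<^sup>2"] assms(2) that by (simp add: idem)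
    then show ?thesis
      using mult_strict_right_mono[of 1 "P j j" "P j j"] by (force simp: power2_eq_square not_le[symmetric])
  qed
  have trace: "(\<Sum>j\<in>J. P j j) = d"
    unfolding P_def by (subst sum.swap) (simp add: f(3))
  define G where "G = {j\<in>J. P j j \<ge> \<theta>}"
  \<comment> \<open>Diagonal entries are at most 1 on \<open>G\<close> and below
    \<open>\<theta>\<close> off it, so the trace \<open>d\<close> forces \<open>G\<close> to be
    large.\<close>
  have "real d \<le> (\<Sum>j\<in>J. (if j \<in> G then 1 else 0) + \<theta>)"
    unfolding trace[symmetric]
    by (intro sum_mono) (use le1 assms(3) in \<open>auto simp: G_def add_increasing2\<close>)
  also have "\<dots> = card G + \<theta> * card J"
    using assms(2) by (simp add: sum.distrib G_def sum.If_cases Int_def)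
  finally have "real (card G) \<ge> (1 - \<theta>) * card J - card A"
    using True by (simp add: d_def of_nat_diff algebra_simps)
  moreover have "\<exists>v. (\<forall>i. i \<notin> J \<longrightarrow> v i = 0) \<and> (\<forall>a\<in>A. (\<Sum>i\<in>J. a i * v i) = 0) \<and>
        v j = (\<Sum>i\<in>J. (v i)\<^sup>2) \<and> \<theta> \<le> v j \<and> v j \<le> 1" if "j \<in> G" for j
    by (rule exI[of _ "P j"]) (use that supp ann idem le1 in \<open>auto simp: G_def\<close>)
  ultimately show ?thesis
    using that[of G] by (auto simp: G_def)
qed

section \<open>Transversals\<close>

text \<open>Union bound over uniformly chosen transversals. A given \<open>G k\<close> is missed
  with probability the product of \<open>1 - card (D s \<inter> G k) / n\<close>, hence at most
  \<open>exp (- \<delta> * card S)\<close>; fewer than \<open>exp (\<delta> * card S)\<close> such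
  events cannot exhaust all transversals.\<close>

lemma transversal_meeting_all:
  fixes G :: "'k \<Rightarrow> 'a set" and D :: "'s \<Rightarrow> 'a set" and \<delta> :: real
  assumes "finite S" "\<And>s. s \<in> S \<Longrightarrow> finite (D s) \<and> card (D s) = n" "n > 0"
    and disj: "disjoint_family_on D S"
    and "finite K" "\<And>k. k \<in> K \<Longrightarrow> G k \<subseteq> (\<Union>s\<in>S. D s)"
    and big: "\<And>k. k \<in> K \<Longrightarrow> real (card (G k)) \<ge> \<delta> * real (card S * n)"
    and few: "real (card K) < exp (\<delta> * card S)"
  obtains i where "i \<in> Pi S D" "\<And>k. k \<in> K \<Longrightarrow> \<exists>s\<in>S. i s \<in> G k"
proof -
  have cardPi: "real (card (Pi\<^sub>E S D)) = real n ^ card S"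
    using assms by (simp add: card_PiE)
  define bad where "bad k = Pi\<^sub>E S (\<lambda>s. D s - G k)" for k
  have badcard: "real (card (bad k)) \<le> real n ^ card S * exp (- \<delta> * card S)" if k: "k \<in> K" for k
  proof -
    have fac: "real (card (D s - G k)) \<le> real n * exp (- real (card (D s \<inter> G k)) / n)"
      if "s \<in> S" for s
    proof -
      have "real (card (D s - G k)) = real n - card (D s \<inter> G k)"
        using assms(2)[OF that]
        by (metis Diff_Int_distrib2 Int_lower1 card_Diff_subset_Int card_mono finite_Int of_nat_diff)
      also have "\<dots> = real n * (1 + (- real (card (D s \<inter> G k)) / n))"
        using assms(3) by (simp add: field_simps)
      also have "\<dots> \<le> real n * exp (- real (card (D s \<inter> G k)) / n)"
        by (intro mult_left_mono exp_ge_add_one_self) auto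
      finally show ?thesis .
    qed
    have "(\<Sum>s\<in>S. card (D s \<inter> G k)) = card (\<Union>s\<in>S. D s \<inter> G k)"
      using assms(1,2) disj
      by (subst card_UN_disjoint) (auto simp: disjoint_family_on_def)
    also have "(\<Union>s\<in>S. D s \<inter> G k) = G k"
      using assms(6)[OF k] by blast
    finally have sum: "(\<Sum>s\<in>S. real (card (D s \<inter> G k))) = card (G k)"
      by (metis of_nat_sum)
    have "real (card (bad k)) = (\<Prod>s\<in>S. real (card (D s - G k)))"
      unfolding bad_def using assms(1) by (simp add: card_PiE)
    also have "\<dots> \<le> (\<Prod>s\<in>S. real n * exp (- real (card (D s \<inter> G k)) / n))"
      using fac by (intro prod_mono) auto
    also have "\<dots> = real n ^ card S * exp (- real (card (G k)) / n)"
      using assms(1) sum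
      by (simp add: prod.distrib exp_sum[symmetric] sum_negf sum_divide_distrib[symmetric])
    also have "\<dots> \<le> real n ^ card S * exp (- \<delta> * card S)"
      using big[OF k] assms(3) by (intro mult_left_mono) (auto simp: field_simps)
    finally show ?thesis .
  qed
  have "real (card (\<Union>k\<in>K. bad k)) \<le> (\<Sum>k\<in>K. real (card (bad k)))"
    using card_UN_le[OF assms(5), of bad] by (metis of_nat_le_iff of_nat_sum)
  also have "\<dots> \<le> (\<Sum>k\<in>K. real n ^ card S * exp (- \<delta> * card S))"
    by (intro sum_mono badcard)
  also have "\<dots> < exp (\<delta> * card S) * (real n ^ card S * exp (- \<delta> * card S))"
    using few assms(3) by (simp add: mult_strict_right_mono)
  also have "\<dots> = card (Pi\<^sub>E S D)"
    by (simp add: cardPi exp_minus field_simps)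
  finally have lt: "card (\<Union>k\<in>K. bad k) < card (Pi\<^sub>E S D)"
    by simp
  have "finite (\<Union>k\<in>K. bad k)"
    using assms(1,2,5) by (auto simp: bad_def intro!: finite_PiE)
  with lt have "\<not> Pi\<^sub>E S D \<subseteq> (\<Union>k\<in>K. bad k)"
    by (meson card_mono leD)
  then obtain i where i: "i \<in> Pi\<^sub>E S D" "\<And>k. k \<in> K \<Longrightarrow> i \<notin> bad k"
    by blast
  show thesis
  proof (rule that[of i])
    show "i \<in> Pi S D"
      using i(1) by (auto simp: PiE_def)
    show "\<exists>s\<in>S. i s \<in> G k" if "k \<in> K" for k
      using i(1) i(2)[OF that] by (auto simp: bad_def PiE_iff)
  qed
qed

text \<open>Chernoff-type count: weigh each \<open>F\<close> by \<open>x ^ card F\<close> with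
  \<open>x = exp (- 3)\<close>. All subsets together weigh
  \<open>(1 + x) ^ m \<le> exp (m / 16)\<close>, while each small \<open>F\<close> weighs at least
  \<open>exp (- m / 16)\<close>.\<close>

lemma card_small_subsets_le:
  assumes "finite S"
  shows "real (card {F. F \<subseteq> S \<and> 48 * card F \<le> card S}) \<le> exp (real (card S) / 8)"
proof -
  define m where "m = card S"
  define x :: real where "x = exp (- 3)"
  \<comment> \<open>Amounts to \<open>exp 3 \<ge> 16\<close>, which follows from
    \<open>exp (3 / 4) \<ge> 1 + 3 / 4 + 9 / 32 > 2\<close>.\<close>
  have x: "x \<le> 1 / 16"
  proof -
    have "(16::real) = 2 ^ 4"
      by simp
    also have "\<dots> \<le> exp (3 / 4) ^ 4"
      using exp_lower_Taylor_quadratic[of "3 / 4 :: real"]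
      by (intro power_mono) (auto simp: power2_eq_square)
    also have "\<dots> = exp 3"
      by (simp flip: exp_of_nat_mult)
    finally show ?thesis
      by (simp add: x_def exp_minus field_simps)
  qed
  have weight: "exp (- real m / 16) \<le> x ^ card F" if "48 * card F \<le> card S" for F :: "'a set"
  proof -
    have "exp (- real m / 16) \<le> exp (- 3 * real (card F))"
      using that by (simp add: m_def)
    also have "\<dots> = x ^ card F"
      by (simp add: x_def exp_of_nat_mult[symmetric] mult.commute)
    finally show ?thesis .
  qed
  have "real (card {F. F \<subseteq> S \<and> 48 * card F \<le> card S}) * exp (- real m / 16)
      = (\<Sum>F | F \<subseteq> S \<and> 48 * card F \<le> card S. exp (- real m / 16))"
    by simp
  also have "\<dots> \<le> (\<Sum>F | F \<subseteq> S \<and> 48 * card F \<le> card S. x ^ card F)"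
    by (intro sum_mono weight) auto
  also have "\<dots> \<le> (\<Sum>F\<in>Pow S. x ^ card F)"
    using assms by (intro sum_mono2) (auto simp: x_def)
  also have "\<dots> = (x + 1) ^ m"
    using prod_add[OF assms, of "\<lambda>_. x" "\<lambda>_. 1"] by (simp add: m_def)
  also have "\<dots> \<le> exp x ^ m"
    using exp_ge_add_one_self[of x] by (intro power_mono) (auto simp: x_def add.commute)
  also have "\<dots> = exp (real m * x)"
    by (simp add: exp_of_nat_mult)
  also have "\<dots> \<le> exp (real m / 16)"
    using mult_left_mono[OF x, of "real m"] by simp
  finally have "real (card {F. F \<subseteq> S \<and> 48 * card F \<le> card S}) \<le> exp (real m / 16) * exp (real m / 16)"
    by (simp add: exp_minus field_simps)
  also have "\<dots> = exp (real m / 8)"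
    by (simp flip: exp_add)
  finally show ?thesis
    by (simp add: m_def)
qed

section \<open>The extremal vector\<close>

text \<open>Here \<open>r = \<parallel>y\<parallel>\<^sup>2\<close>, \<open>b = \<parallel>v\<parallel>\<^sup>2\<close>, \<open>a = \<langle>y, v\<rangle>\<close> on one block, so the factors on the right are
  \<open>1 - \<parallel>y + tv\<parallel>\<^sup>2\<close> and \<open>1 - \<parallel>y - tv\<parallel>\<^sup>2\<close>.\<close>

lemma prod_increments_ge:
  fixes r a b t :: real
  assumes "0 \<le> r" "r \<le> 1 / 2" "0 \<le> b" "a\<^sup>2 \<le> r * b"
  shows "(1 - r)\<^sup>2 * (1 - 12 * (t\<^sup>2 * b))
    \<le> (1 - (r + 2 * t * a + t\<^sup>2 * b)) * (1 - (r - 2 * t * a + t\<^sup>2 * b))"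
proof -
  have "(1 - (r + 2 * t * a + t\<^sup>2 * b)) * (1 - (r - 2 * t * a + t\<^sup>2 * b))
     = (1 - r)\<^sup>2 - 2 * (1 - r) * (t\<^sup>2 * b) + (t\<^sup>2 * b)\<^sup>2 - 4 * t\<^sup>2 * a\<^sup>2"
    by (simp add: power2_eq_square algebra_simps)
  moreover have "4 * t\<^sup>2 * a\<^sup>2 \<le> 4 * r * (t\<^sup>2 * b)"
    using mult_left_mono[OF assms(4), of "4 * t\<^sup>2"] by (simp add: mult_ac)
  \<comment> \<open>Equality holds at \<open>r = 1 / 2\<close>, so 12 is the smallest constant valid
    up to that threshold.\<close>
  moreover have "2 * (1 - r) + 4 * r \<le> 12 * (1 - r)\<^sup>2"
  proof -
    have "0 \<le> (1 / 2 - r) * (20 - 12 * r)"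
      using assms by (intro mult_nonneg_nonneg) auto
    also have "\<dots> = 12 * (1 - r)\<^sup>2 - (2 * (1 - r) + 4 * r)"
      by (simp add: power2_eq_square algebra_simps)
    finally show ?thesis by simp
  qed
  then have "(2 * (1 - r) + 4 * r) * (t\<^sup>2 * b) \<le> 12 * (1 - r)\<^sup>2 * (t\<^sup>2 * b)"
    using assms by (intro mult_right_mono) auto
  moreover have "(2 * (1 - r) + 4 * r) * (t\<^sup>2 * b) = 2 * (1 - r) * (t\<^sup>2 * b) + 4 * r * (t\<^sup>2 * b)"
    by (rule distrib_right)
  moreover have "(1 - r)\<^sup>2 * (1 - 12 * (t\<^sup>2 * b)) = (1 - r)\<^sup>2 - 12 * (1 - r)\<^sup>2 * (t\<^sup>2 * b)"
    by (simp add: right_diff_distrib)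
  ultimately show ?thesis
    using zero_le_power2[of "t\<^sup>2 * b"] by linarith
qed

text \<open>\<open>escape\<close> says that no small \<open>F\<close> blocks every useful direction
  of \<open>E\<close>. Its identity between \<open>v (i s)\<close> and the squared norm of
  \<open>v\<close> is that of a projected unit vector; it makes the gain at one coordinate
  comparable with the loss over all blocks.\<close>

lemma extremal_vector_large_on_transversal:
  fixes A :: "('a \<Rightarrow> real) set" and S :: "'s set" and D :: "'s \<Rightarrow> 'a set"
  defines "E \<equiv> {v. (\<forall>j. j \<notin> (\<Union>s\<in>S. D s) \<longrightarrow> v j = 0) \<and> (\<forall>a\<in>A. (\<Sum>j\<in>(\<Union>s\<in>S. D s). a j * v j) = 0)}"
  assumes fin: "finite S" "\<And>s. s \<in> S \<Longrightarrow> finite (D s)" and disj: "disjoint_family_on D S"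
    and i: "i \<in> Pi S D"
    and escape: "\<And>F. F \<subseteq> S \<Longrightarrow> 48 * card F \<le> card S \<Longrightarrow>
      \<exists>s\<in>S. \<exists>v\<in>E. (\<forall>t\<in>F. \<forall>j\<in>D t. v j = 0) \<and>
        v (i s) = (\<Sum>j\<in>(\<Union>s\<in>S. D s). (v j)\<^sup>2) \<and> 1 / 4 \<le> v (i s) \<and> v (i s) \<le> 1"
  obtains y where "y \<in> E" "\<And>s. s \<in> S \<Longrightarrow> (\<Sum>j\<in>D s. (y j)\<^sup>2) \<le> 1"
    "(\<Sum>s\<in>S. (y (i s))\<^sup>2) \<ge> real (card S) / 4608"
proof -
  define J where "J = (\<Union>s\<in>S. D s)"
  have finJ: "finite J"
    using fin by (auto simp: J_def)
  have E: "E = {v. (\<forall>j. j \<notin> J \<longrightarrow> v j = 0) \<and> (\<forall>a\<in>A. (\<Sum>j\<in>J. a j * v j) = 0)}"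
    by (simp add: E_def J_def)
  define r where "r y s = (\<Sum>j\<in>D s. (y j)\<^sup>2)" for y :: "'a \<Rightarrow> real" and s
  define Q where "Q y = (\<Sum>s\<in>S. (y (i s))\<^sup>2)" for y :: "'a \<Rightarrow> real"
  define K where "K = {y\<in>E. \<forall>s\<in>S. r y s \<le> 1}"
  define H where "H y = exp (48 * Q y) * (\<Prod>s\<in>S. 1 - r y s)" for y
  have r_nonneg: "r y s \<ge> 0" for y s
    by (simp add: r_def sum_nonneg)
  have coord: "continuous_on UNIV (\<lambda>y :: 'a \<Rightarrow> real. y j)" for j
    by simp
  have cont_r: "continuous_on UNIV (\<lambda>y. r y s)" for s
    unfolding r_def by (intro continuous_intros coord)
  have "continuous_on UNIV H"
    unfolding H_def Q_def by (intro continuous_intros coord cont_r)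
  then have contH: "continuous_on K H"
    by (rule continuous_on_subset) simp
  \<comment> \<open>\<open>K\<close> is closed in a product of intervals and singletons, which is
    compact by Tychonoff.\<close>
  have "compact K"
  proof -
    have "compact (Pi\<^sub>E UNIV (\<lambda>j. if j \<in> J then {-1..1::real} else {0}))" (is "compact ?P")
      using compactin_PiE[of "\<lambda>_::'a. euclidean :: real topology" UNIV]
      by (auto simp: euclidean_product_topology)
    moreover have "closed K"
    proof -
      have "K = (\<Inter>j\<in>-J. {y. y j = 0}) \<inter> (\<Inter>a\<in>A. {y. (\<Sum>j\<in>J. a j * y j) = 0}) \<inter> (\<Inter>s\<in>S. {y. r y s \<le> 1})"
        by (auto simp: K_def E)
      also have "closed \<dots>"
        by (intro closed_Int closed_INT ballI closed_Collect_eq closed_Collect_le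
            continuous_intros coord cont_r)
      finally show ?thesis .
    qed
    moreover have "K \<subseteq> ?P"
    proof
      fix y assume y: "y \<in> K"
      have "y j \<in> {-1..1}" if "j \<in> J" for j
      proof -
        obtain s where s: "s \<in> S" "j \<in> D s"
          using \<open>j \<in> J\<close> unfolding J_def by blast
        then have "(y j)\<^sup>2 \<le> r y s"
          unfolding r_def using fin by (intro member_le_sum) auto
        also have "\<dots> \<le> 1"
          using y s by (simp add: K_def)
        finally show ?thesis
          by (simp add: abs_square_le_1 abs_le_iff)
      qed
      then show "y \<in> ?P"
        using y by (auto simp: K_def E PiE_iff)
    qed
    ultimately show ?thesis
      by (metis compact_Int_closed inf.absorb_iff2)
  qed
  moreover have K0: "(\<lambda>_. 0) \<in> K"
    by (auto simp: K_def E r_def)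
  ultimately obtain y where y: "y \<in> K" and ymax: "\<And>z. z \<in> K \<Longrightarrow> H z \<le> H y"
    using continuous_attains_sup[of K H] contH by blast
  \<comment> \<open>Comparison with the zero vector, where \<open>H\<close> equals 1.\<close>
  have H1: "1 \<le> H y"
    using ymax[OF K0] by (simp add: H_def Q_def r_def)
  \<comment> \<open>A block of norm 1 would make the product in \<open>H\<close> vanish, against
    \<open>H1\<close>.\<close>
  have rlt: "r y s < 1" if "s \<in> S" for s
  proof (rule ccontr)
    assume "\<not> r y s < 1"
    then have "1 - r y s = 0"
      using y that by (force simp: K_def)
    then have "H y = 0"
      using that fin(1) by (auto simp: H_def)
    then show False
      using H1 by simp
  qed
  define F where "F = {s\<in>S. r y s > 1 / 2}"
  have FS: "F \<subseteq> S" "finite F"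
    using fin(1) by (auto simp: F_def)
  \<comment> \<open>Otherwise some admissible direction \<open>v\<close> is invisible to the nearly saturated blocks, and
    \<open>H (y + v / 10) * H (y - v / 10) > (H y)\<^sup>2\<close> contradicts the maximality of \<open>y\<close>.\<close>
  have Fbig: "48 * card F > card S"
  proof (rule ccontr)
    assume "\<not> 48 * card F > card S"
    then obtain s0 v where s0: "s0 \<in> S" and vE: "v \<in> E" and vF: "\<And>t j. t \<in> F \<Longrightarrow> j \<in> D t \<Longrightarrow> v j = 0"
      and vi: "v (i s0) = (\<Sum>j\<in>J. (v j)\<^sup>2)" and vb: "1 / 4 \<le> v (i s0)" "v (i s0) \<le> 1"
      using escape[OF FS(1)] unfolding J_def by (meson not_less)
    define \<kappa> where "\<kappa> = v (i s0)"
    have sumr: "(\<Sum>s\<in>S. r v s) = \<kappa>"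
      unfolding \<kappa>_def vi J_def r_def using fin disj
      by (subst sum.UNION_disjoint) (auto simp: disjoint_family_on_def)
    have rle: "r v s \<le> 1" if "s \<in> S" for s
      using member_le_sum[of s S "r v"] that fin(1) r_nonneg sumr vb by (simp add: \<kappa>_def)
    define a where "a s = (\<Sum>j\<in>D s. y j * v j)" for s
    have a2: "(a s)\<^sup>2 \<le> r y s * r v s" for s
      unfolding a_def r_def using Cauchy_Schwarz_ineq_sum[of y v "D s"] by simp
    define z where "z t = (\<lambda>j. y j + t * v j)" for t
    have rz: "r (z t) s = r y s + 2 * t * a s + t\<^sup>2 * r v s" for t s
      unfolding r_def z_def a_def sum_distrib_left sum.distrib[symmetric]
      by (intro sum.cong refl) (simp add: power2_eq_square algebra_simps)
    have rF: "r v s = 0" "a s = 0" if "s \<in> F" for s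
      using vF[OF that] by (auto simp: r_def a_def)
    have zE: "z t \<in> E" for t
      using y vE
      by (auto simp: z_def K_def E distrib_left sum.distrib mult.left_commute[of _ t]
          simp flip: sum_distrib_left)
    \<comment> \<open>Blocks in \<open>F\<close> are unchanged, and on the others the squared norm
      is at most \<open>1 / 2 + 1 / 5 + 1 / 100 < 1\<close>.\<close>
    have zK: "z t \<in> K" if t: "t = 1 / 10 \<or> t = - 1 / 10" for t
    proof -
      have "r (z t) s \<le> 1" if s: "s \<in> S" for s
      proof (cases "s \<in> F")
        case True
        then show ?thesis
          using rF[OF True] y s by (simp add: rz K_def)
      next
        case False
        have "(a s)\<^sup>2 \<le> 1 * 1"
          using a2[of s] rle[OF s] rlt[OF s] r_nonneg mult_mono[of "r y s" 1 "r v s" 1] by simp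
        then have "\<bar>a s\<bar> \<le> 1"
          by (simp add: abs_square_le_1)
        moreover have "\<bar>t\<bar> \<le> 1 / 10"
          using t by auto
        ultimately have "\<bar>t * a s\<bar> \<le> 1 / 10 * 1"
          unfolding abs_mult by (intro mult_mono) auto
        then have "2 * t * a s \<le> 1 / 5"
          by linarith
        moreover have "t\<^sup>2 = (1 / 10)\<^sup>2"
          unfolding power2_eq_iff using t by simp
        then have "t\<^sup>2 = 1 / 100"
          by (simp add: power_divide)
        moreover have "t\<^sup>2 * r v s \<le> t\<^sup>2 * 1"
          using rle[OF s] by (intro mult_left_mono) auto
        ultimately show ?thesis
          using False s unfolding rz by (simp add: F_def)
      qed
      then show ?thesis
        using zE by (simp add: K_def)
    qed
    \<comment> \<open>The terms linear in \<open>v\<close> cancel, leaving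
      \<open>2 * (1 / 10)\<^sup>2 = 1 / 50\<close> times the sum of squares. Only its term at
      \<open>s0\<close> is kept, and \<open>\<kappa> \<ge> 1 / 4\<close> makes it linear in
      \<open>\<kappa>\<close>.\<close>
    have "Q (z (1 / 10)) + Q (z (- 1 / 10)) = 2 * Q y + (\<Sum>s\<in>S. (v (i s))\<^sup>2) / 50"
      unfolding Q_def z_def sum_distrib_left sum.distrib[symmetric] sum_divide_distrib
      by (intro sum.cong refl) (simp add: power2_eq_square algebra_simps)
    moreover have "\<kappa>\<^sup>2 \<le> (\<Sum>s\<in>S. (v (i s))\<^sup>2)"
      unfolding \<kappa>_def using s0 fin(1) by (intro member_le_sum) auto
    moreover have "\<kappa> / 4 \<le> \<kappa>\<^sup>2"
      using vb mult_right_mono[of "1/4" \<kappa> \<kappa>] by (simp add: \<kappa>_def power2_eq_square)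
    ultimately have Qz: "Q (z (1 / 10)) + Q (z (- 1 / 10)) \<ge> 2 * Q y + \<kappa> / 200"
      by simp
    \<comment> \<open>By \<open>prod_increments_ge\<close>, a block outside \<open>F\<close> loses
      at most the factor \<open>1 - 12 / 100 * r v s\<close>. The Weierstrass product inequality
      bounds the total loss through \<open>\<kappa>\<close> alone, whatever the number of
      blocks.\<close>
    have "(\<Prod>s\<in>S. 1 - r y s)\<^sup>2 * (1 - 12 / 100 * \<kappa>)
      \<le> (\<Prod>s\<in>S. 1 - r y s)\<^sup>2 * (\<Prod>s\<in>S. 1 - 12 / 100 * r v s)"
    proof (intro mult_left_mono)
      have "1 - (\<Sum>s\<in>S. 12 / 100 * r v s) \<le> (\<Prod>s\<in>S. 1 - 12 / 100 * r v s)"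
      proof (rule Weierstrass_prod_ineq)
        fix s assume "s \<in> S"
        then show "12 / 100 * r v s \<in> {0..1}"
          using rle[of s] r_nonneg[of v s] by simp
      qed
      then show "1 - 12 / 100 * \<kappa> \<le> (\<Prod>s\<in>S. 1 - 12 / 100 * r v s)"
        unfolding sum_distrib_left[symmetric] sumr .
    qed simp
    also have "\<dots> = (\<Prod>s\<in>S. (1 - r y s)\<^sup>2 * (1 - 12 * ((1 / 10)\<^sup>2 * r v s)))"
      by (simp add: prod.distrib prod_power_distrib power2_eq_square)
    also have "\<dots> \<le> (\<Prod>s\<in>S. (1 - r (z (1 / 10)) s) * (1 - r (z (- 1 / 10)) s))"
    proof (intro prod_mono conjI)
      fix s assume s: "s \<in> S"
      show "0 \<le> (1 - r y s)\<^sup>2 * (1 - 12 * ((1 / 10)\<^sup>2 * r v s))"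
        using rle[OF s] by (simp add: power2_eq_square)
      show "(1 - r y s)\<^sup>2 * (1 - 12 * ((1 / 10)\<^sup>2 * r v s))
        \<le> (1 - r (z (1 / 10)) s) * (1 - r (z (- 1 / 10)) s)"
      proof (cases "s \<in> F")
        case True
        then show ?thesis
          using rF[OF True] by (simp add: rz power2_eq_square)
      next
        case False
        then show ?thesis
          using prod_increments_ge[of "r y s" "r v s" "a s" "1 / 10"] a2[of s] r_nonneg s
          by (simp add: rz F_def)
      qed
    qed
    finally have prods: "(\<Prod>s\<in>S. 1 - r y s)\<^sup>2 * (1 - 12 / 100 * \<kappa>)
      \<le> (\<Prod>s\<in>S. 1 - r (z (1 / 10)) s) * (\<Prod>s\<in>S. 1 - r (z (- 1 / 10)) s)"
      by (simp add: prod.distrib)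
    \<comment> \<open>The weight 48 makes the gain
      \<open>48 * \<kappa> / 200 = 24 / 100 * \<kappa>\<close> twice the loss
      \<open>12 / 100 * \<kappa>\<close>, so for \<open>0 < \<kappa> \<le> 1\<close> the combined
      factor exceeds 1.\<close>
    have "exp (48 * Q y) * exp (48 * Q y) * (1 + 24 / 100 * \<kappa>)
        \<le> exp (48 * Q y) * exp (48 * Q y) * exp (24 / 100 * \<kappa>)"
      using exp_ge_add_one_self[of "24 / 100 * \<kappa>"] by (intro mult_left_mono) auto
    also have "\<dots> = exp (48 * (2 * Q y + \<kappa> / 200))"
      by (simp add: exp_add[symmetric])
    also have "\<dots> \<le> exp (48 * (Q (z (1 / 10)) + Q (z (- 1 / 10))))"
      using Qz by simp
    also have "\<dots> = exp (48 * Q (z (1 / 10))) * exp (48 * Q (z (- 1 / 10)))"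
      by (simp add: exp_add[symmetric] distrib_left)
    finally have exps: "exp (48 * Q y) * exp (48 * Q y) * (1 + 24 / 100 * \<kappa>)
        \<le> exp (48 * Q (z (1 / 10))) * exp (48 * Q (z (- 1 / 10)))" .
    have "(exp (48 * Q y) * exp (48 * Q y) * (1 + 24 / 100 * \<kappa>)) *
       ((\<Prod>s\<in>S. 1 - r y s)\<^sup>2 * (1 - 12 / 100 * \<kappa>)) \<le> H (z (1 / 10)) * H (z (- 1 / 10))"
      using mult_mono[OF exps prods] vb by (simp add: H_def \<kappa>_def mult_ac)
    then have "H y * H y * ((1 + 24 / 100 * \<kappa>) * (1 - 12 / 100 * \<kappa>)) \<le> H (z (1 / 10)) * H (z (- 1 / 10))"
      by (simp add: H_def power2_eq_square mult_ac)
    also have "\<dots> \<le> H y * H y"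
    proof -
      have "H (z (- 1 / 10)) \<ge> 0"
        using zK[of "- 1 / 10"] by (auto simp: H_def K_def intro!: mult_nonneg_nonneg prod_nonneg)
      then show ?thesis
        using ymax zK H1 by (intro mult_mono) auto
    qed
    finally have "(1 + 24 / 100 * \<kappa>) * (1 - 12 / 100 * \<kappa>) \<le> 1"
      using H1 by (simp add: mult_le_cancel_left1)
    moreover have "(1 + 24 / 100 * \<kappa>) * (1 - 12 / 100 * \<kappa>) = 1 + \<kappa> * (12 / 100 - 288 / 10000 * \<kappa>)"
      by (simp add: algebra_simps)
    moreover have "\<kappa> * (12 / 100 - 288 / 10000 * \<kappa>) > 0"
      using vb by (simp add: \<kappa>_def)
    ultimately show False
      by linarith
  qed
  \<comment> \<open>Each block in \<open>F\<close> contributes a factor below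
    \<open>1 / 2 \<le> exp (- 1 / 2)\<close>. With \<open>H y \<ge> 1\<close> this gives
    \<open>48 * Q y \<ge> card F / 2\<close>, and \<open>card F > card S / 48\<close> yields the
    constant \<open>4608 = 48 * 2 * 48\<close>.\<close>
  have "H y \<le> exp (48 * Q y) * (1 / 2) ^ card F"
  proof -
    have "(\<Prod>s\<in>S. 1 - r y s) \<le> (\<Prod>s\<in>S. if s \<in> F then 1 / 2 else 1)"
      by (intro prod_mono) (use rlt r_nonneg in \<open>auto simp: F_def less_imp_le\<close>)
    also have "\<dots> = (1 / 2) ^ card F"
      using fin(1) FS by (simp add: prod.If_cases Int_absorb1)
    finally show ?thesis
      by (simp add: H_def)
  qed
  also have "\<dots> \<le> exp (48 * Q y) * exp (- 1 / 2) ^ card F"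
    using exp_ge_add_one_self[of "- 1 / 2 :: real"] by (intro mult_left_mono power_mono) auto
  also have "\<dots> = exp (48 * Q y - card F / 2)"
    by (simp add: exp_of_nat_mult[symmetric] exp_add[symmetric])
  finally have "0 \<le> 48 * Q y - card F / 2"
    using H1 by (smt (verit) exp_less_one_iff)
  then have "Q y \<ge> real (card S) / 4608"
    using Fbig by linarith
  then show thesis
    using that[of y] y by (auto simp: K_def r_def Q_def)
qed

section \<open>The mixed norms\<close>

lemma ereal_ge_1_cases:
  assumes "p \<in> {1..\<infinity>::ereal}"
  obtains "p = \<infinity>" "real_of_ereal (1 / p) = 0"
  | P where "p = ereal P" "P \<ge> 1" "real_of_ereal (1 / p) = 1 / P"
  using assms by (cases p) (auto simp: one_ereal_def)

lemma real_of_ereal_inverse_diff: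
  assumes "p \<in> {1..\<infinity>::ereal}" "q \<in> {1..\<infinity>::ereal}"
  shows "real_of_ereal (1 / q - 1 / p) = real_of_ereal (1 / q) - real_of_ereal (1 / p)"
  using assms by (cases p; cases q) (auto simp: one_ereal_def)

lemma lp_norm_finite: "lp_norm (ereal P) I x = (\<Sum>i\<in>I. \<bar>x i\<bar> powr P) powr (1 / P)"
  by (simp add: lp_norm_def)

lemma lp_norm_infinity: "lp_norm \<infinity> I x = Max ((\<lambda>i. \<bar>x i\<bar>) ` I)"
  by (simp add: lp_norm_def)

lemma lp_norm_nonneg:
  assumes "finite I" "I \<noteq> {}"
  shows "0 \<le> lp_norm p I x"
proof (cases "p = \<infinity>")
  case True
  obtain i where "i \<in> I"
    using assms by blast
  then have "\<bar>x i\<bar> \<le> lp_norm p I x"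
    using assms True by (simp add: lp_norm_infinity)
  then show ?thesis
    by linarith
qed (simp add: lp_norm_def)

lemma lp_norm_cong: "(\<And>i. i \<in> I \<Longrightarrow> \<bar>x i\<bar> = \<bar>y i\<bar>) \<Longrightarrow> lp_norm p I x = lp_norm p I y"
  unfolding lp_norm_def by (auto intro!: arg_cong[where f = Max] sum.cong image_cong arg_cong2[where f = "(powr)"])

lemma lp_norm_mono:
  assumes "p \<in> {1..\<infinity>}" "finite I" "I \<noteq> {}" "\<And>i. i \<in> I \<Longrightarrow> \<bar>x i\<bar> \<le> \<bar>y i\<bar>"
  shows "lp_norm p I x \<le> lp_norm p I y"
  using assms(1)
proof (cases rule: ereal_ge_1_cases)
  case 1
  show ?thesis
    unfolding 1 lp_norm_infinity
  proof (intro Max.boundedI)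
    fix u assume "u \<in> (\<lambda>i. \<bar>x i\<bar>) ` I"
    then obtain i where i: "i \<in> I" "u = \<bar>x i\<bar>"
      by blast
    then have "u \<le> \<bar>y i\<bar>"
      using assms(4) by simp
    also have "\<dots> \<le> Max ((\<lambda>i. \<bar>y i\<bar>) ` I)"
      using i assms(2) by simp
    finally show "u \<le> Max ((\<lambda>i. \<bar>y i\<bar>) ` I)" .
  qed (use assms in auto)
next
  case (2 P)
  then show ?thesis
    unfolding 2(1) lp_norm_finite
    by (intro powr_mono2 sum_mono sum_nonneg) (use assms(4) in auto)
qed

lemma abs_le_lp_norm:
  assumes "p \<in> {1..\<infinity>}" "finite I" "i \<in> I"
  shows "\<bar>x i\<bar> \<le> lp_norm p I x"
  using assms(1)
proof (cases rule: ereal_ge_1_cases)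
  case 1
  then show ?thesis
    using assms by (simp add: lp_norm_infinity)
next
  case (2 P)
  have "\<bar>x i\<bar> = (\<bar>x i\<bar> powr P) powr (1 / P)"
    using 2(2) by (simp add: powr_powr)
  also have "\<dots> \<le> lp_norm p I x"
    unfolding 2(1) lp_norm_finite
    using assms 2(2) by (intro powr_mono2 member_le_sum) auto
  finally show ?thesis .
qed

text \<open>Every entry is at most the l_P norm \<open>a\<close>, so
  \<open>\<bar>x i\<bar> powr Q\<close> is at most
  \<open>a powr (Q - P) * \<bar>x i\<bar> powr P\<close>, which sums to
  \<open>a powr Q\<close>.\<close>

lemma lp_norm_antimono:
  assumes "p \<in> {1..\<infinity>}" "q \<in> {1..\<infinity>}" "p \<le> q" "finite I" "I \<noteq> {}"
  shows "lp_norm q I x \<le> lp_norm p I x"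
  using assms(2)
proof (cases rule: ereal_ge_1_cases)
  case 1
  show ?thesis
    unfolding 1 lp_norm_infinity using assms by (auto intro!: abs_le_lp_norm)
next
  case (2 Q)
  with assms obtain P where P: "p = ereal P" "1 \<le> P" "P \<le> Q"
    by (cases p) (auto simp: one_ereal_def)
  define a where "a = lp_norm p I x"
  have a: "0 \<le> a"
    using assms by (simp add: a_def lp_norm_nonneg)
  have sumP: "(\<Sum>i\<in>I. \<bar>x i\<bar> powr P) = a powr P"
    unfolding a_def P(1) lp_norm_finite using P(2) by (simp add: powr_powr sum_nonneg)
  have "(\<Sum>i\<in>I. \<bar>x i\<bar> powr Q) \<le> (\<Sum>i\<in>I. a powr (Q - P) * \<bar>x i\<bar> powr P)"
  proof (intro sum_mono)
    fix i assume "i \<in> I"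
    then have "\<bar>x i\<bar> \<le> a"
      using assms by (simp add: a_def abs_le_lp_norm)
    then have "\<bar>x i\<bar> powr (Q - P) * \<bar>x i\<bar> powr P \<le> a powr (Q - P) * \<bar>x i\<bar> powr P"
      using P(3) by (intro mult_right_mono powr_mono2) auto
    then show "\<bar>x i\<bar> powr Q \<le> a powr (Q - P) * \<bar>x i\<bar> powr P"
      by (simp flip: powr_add)
  qed
  also have "\<dots> = a powr Q"
    by (simp add: sum_distrib_left[symmetric] sumP powr_add[symmetric])
  finally have "lp_norm q I x \<le> (a powr Q) powr (1 / Q)"
    unfolding 2(1) lp_norm_finite using 2(2) by (intro powr_mono2 sum_nonneg) auto
  then show ?thesis
    using a 2(2) by (simp add: powr_powr a_def)
qed

section \<open>Power means and the reverse comparison of l_p norms\<close>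

lemma Bernoulli_powr:
  fixes u r :: real
  assumes "0 \<le> u" "1 \<le> r"
  shows "1 + r * (u - 1) \<le> u powr r"
proof (cases "r = 1")
  case False
  \<comment> \<open>Young's inequality for the product \<open>u * 1\<close> with conjugate exponents
    \<open>r\<close> and \<open>r / (r - 1)\<close>.\<close>
  then have "u * 1 \<le> u powr r / r + 1 powr (r / (r - 1)) / (r / (r - 1))"
    using assms by (intro Youngs_inequality) (auto simp: field_simps)
  also have "\<dots> = (u powr r + (r - 1)) / r"
    using assms by (simp add: add_divide_distrib)
  finally show ?thesis
    using assms by (simp add: pos_le_divide_eq algebra_simps)
qed (use assms in simp)

text \<open>Jensen's inequality by the tangent line at the mean \<open>M\<close>: Bernoulli is
  applied to \<open>f i / M\<close>, and the linear terms sum to zero.\<close>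

lemma power_mean_powr:
  fixes f :: "'a \<Rightarrow> real"
  assumes "finite I" "I \<noteq> {}" "\<And>i. i \<in> I \<Longrightarrow> 0 \<le> f i" "1 \<le> r"
  shows "card I * ((\<Sum>i\<in>I. f i) / card I) powr r \<le> (\<Sum>i\<in>I. f i powr r)"
proof -
  define M where "M = (\<Sum>i\<in>I. f i) / card I"
  have n: "real (card I) > 0"
    using assms by (simp add: card_gt_0_iff)
  have sum: "(\<Sum>i\<in>I. f i) = M * card I"
    using n by (simp add: M_def)
  have M: "M \<ge> 0"
    using assms(3) by (simp add: M_def sum_nonneg)
  show ?thesis
  proof (cases "M = 0")
    case True
    then show ?thesis
      by (simp add: M_def[symmetric] sum_nonneg)
  next
    case False
    then have M: "M > 0"
      using M by simp
    have "real (card I) = (\<Sum>i\<in>I. 1 + r * (f i / M - 1))"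
      using M by (simp add: sum.distrib sum_distrib_left[symmetric] sum_subtractf
          sum_divide_distrib[symmetric] sum)
    also have "\<dots> \<le> (\<Sum>i\<in>I. (f i / M) powr r)"
      using assms M by (intro sum_mono Bernoulli_powr) auto
    also have "\<dots> = (\<Sum>i\<in>I. f i powr r) / M powr r"
      using assms(3) M by (simp add: powr_divide sum_divide_distrib)
    finally show ?thesis
      using M by (simp add: M_def[symmetric] field_simps)
  qed
qed

text \<open>For finite exponents this is the power mean inequality with exponent
  \<open>P / Q\<close>; for \<open>p = \<infinity>\<close> every entry is bounded by the
  maximum.\<close>

lemma lp_norm_le_card_powr_mult:
  assumes "p \<in> {1..\<infinity>}" "q \<in> {1..\<infinity>}" "q \<le> p" "finite I" "I \<noteq> {}"
  shows "lp_norm q I x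
    \<le> real (card I) powr (real_of_ereal (1 / q) - real_of_ereal (1 / p)) * lp_norm p I x"
  using assms(2)
proof (cases rule: ereal_ge_1_cases)
  case 1
  with assms show ?thesis
    by (simp add: card_gt_0_iff)
next
  case (2 Q)
  note Q = this
  have n: "real (card I) > 0"
    using assms by (simp add: card_gt_0_iff)
  from assms(1) show ?thesis
  proof (cases rule: ereal_ge_1_cases)
    case 1
    define a where "a = lp_norm p I x"
    have a: "0 \<le> a"
      using assms by (simp add: a_def lp_norm_nonneg)
    have "(\<Sum>i\<in>I. \<bar>x i\<bar> powr Q) \<le> (\<Sum>i\<in>I. a powr Q)"
      using Q(2) assms by (intro sum_mono powr_mono2) (auto simp: a_def abs_le_lp_norm)
    also have "\<dots> = card I * a powr Q"
      by simp
    finally have "lp_norm q I x \<le> (card I * a powr Q) powr (1 / Q)"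
      unfolding Q(1) lp_norm_finite using Q(2) by (intro powr_mono2 sum_nonneg) auto
    then show ?thesis
      using a Q n 1 by (simp add: powr_mult powr_powr a_def)
  next
    case (2 P)
    have PQ: "Q \<le> P"
      using assms(3) Q(1) 2(1) by simp
    define a b where "a = (\<Sum>i\<in>I. \<bar>x i\<bar> powr P)" and "b = (\<Sum>i\<in>I. \<bar>x i\<bar> powr Q)"
    have ab: "a \<ge> 0" "b \<ge> 0"
      by (auto simp: a_def b_def sum_nonneg)
    have "card I * (b / card I) powr (P / Q) \<le> (\<Sum>i\<in>I. (\<bar>x i\<bar> powr Q) powr (P / Q))"
      unfolding b_def using assms PQ Q(2) by (intro power_mean_powr) auto
    also have "\<dots> = a"
      using Q(2) by (simp add: a_def powr_powr)
    finally have "(b / card I) powr (P / Q) \<le> a / card I"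
      using n by (simp add: field_simps)
    then have "((b / card I) powr (P / Q)) powr (1 / P) \<le> (a / card I) powr (1 / P)"
      using 2(2) by (intro powr_mono2) auto
    then have "b powr (1 / Q) / card I powr (1 / Q) \<le> a powr (1 / P) / card I powr (1 / P)"
      using 2(2) Q(2) ab n by (simp add: powr_powr powr_divide)
    then have "b powr (1 / Q) \<le> card I powr (1 / Q - 1 / P) * a powr (1 / P)"
      using n by (simp add: powr_diff field_simps)
    then show ?thesis
      unfolding Q(3) 2(3) unfolding Q(1) 2(1) lp_norm_finite a_def b_def .
  qed
qed

lemma lp_norm_2: "lp_norm 2 I x = sqrt (\<Sum>i\<in>I. (x i)\<^sup>2)"
proof -
  have "lp_norm (ereal 2) I x = sqrt (\<Sum>i\<in>I. (x i)\<^sup>2)"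
    unfolding lp_norm_finite by (simp add: powr_half_sqrt sum_nonneg)
  then show ?thesis
    by simp
qed

lemma lp_norm_1: "lp_norm 1 I x = (\<Sum>i\<in>I. \<bar>x i\<bar>)"
  using lp_norm_finite[of 1 I x] by (simp add: sum_nonneg one_ereal_def)

lemma lp_norm_const:
  assumes "p \<in> {1..\<infinity>}" "finite I" "I \<noteq> {}" "c \<ge> 0"
  shows "lp_norm p I (\<lambda>_. c) = c * real (card I) powr real_of_ereal (1 / p)"
  using assms(1)
proof (cases rule: ereal_ge_1_cases)
  case 1
  then show ?thesis
    using assms by (simp add: lp_norm_infinity image_constant_conv card_gt_0_iff)
next
  case (2 P)
  then show ?thesis
    unfolding 2(3) unfolding 2(1) lp_norm_finite
    using assms by (simp add: powr_mult powr_powr mult.commute)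
qed

lemma lp_norm_single:
  assumes "p \<in> {1..\<infinity>}" "finite I" "k \<in> I"
  shows "lp_norm p I (\<lambda>i. if i = k then c else 0) = \<bar>c\<bar>"
  using assms(1)
proof (cases rule: ereal_ge_1_cases)
  case 1
  have "Max ((\<lambda>i. \<bar>if i = k then c else 0\<bar>) ` I) = \<bar>c\<bar>"
    using assms by (intro Max_eqI) auto
  then show ?thesis
    by (simp add: 1 lp_norm_infinity)
next
  case (2 P)
  have "(\<Sum>i\<in>I. \<bar>if i = k then c else 0\<bar> powr P) = (\<Sum>i\<in>I. if i = k then \<bar>c\<bar> powr P else 0)"
    by (intro sum.cong) auto
  also have "\<dots> = \<bar>c\<bar> powr P"
    using assms by simp
  finally show ?thesis
    unfolding 2(1) lp_norm_finite using 2(2) by (simp add: powr_powr)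
qed

section \<open>The partition into blocks and the comparison of mixed norms\<close>

lemma finite_block [simp]: "finite (block n s)"
  by (simp add: block_def)

lemma block_nonempty [simp]: "n \<ge> 1 \<Longrightarrow> s \<ge> 1 \<Longrightarrow> block n s \<noteq> {}"
  by (cases s) (auto simp: block_def)

lemma card_block: "s \<ge> 1 \<Longrightarrow> card (block n s) = n"
  by (cases s) (auto simp: block_def)

text \<open>The block index is a function of the coordinate, which gives disjointness. The shifts
  come from numbering both from 1.\<close>

lemma mem_block_iff:
  assumes n: "n \<ge> 1" "s \<ge> 1"
  shows "j \<in> block n s \<longleftrightarrow> j \<ge> 1 \<and> s = (j - 1) div n + 1"
proof -
  from n obtain t where t: "s = Suc t"
    by (cases s) auto
  show ?thesis
  proof (cases j)
    case 0
    then show ?thesis by (simp add: block_def)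
  next
    case (Suc k)
    have "j \<in> block n s \<longleftrightarrow> t * n \<le> k \<and> k < Suc t * n"
      unfolding block_def Suc t by auto
    also have "\<dots> \<longleftrightarrow> k div n = t"
      using n less_eq_div_iff_mult_less_eq[of n t k] div_less_iff_less_mult[of n k "Suc t"] by auto
    finally show ?thesis
      using Suc t by auto
  qed
qed

lemma disjoint_family_block: "n \<ge> 1 \<Longrightarrow> disjoint_family_on (block n) {1..m}"
  by (auto simp: disjoint_family_on_def mem_block_iff)

lemma UN_block: "n \<ge> 1 \<Longrightarrow> (\<Union>s\<in>{1..m}. block n s) = {1..m * n}"
proof (induction m)
  case (Suc m)
  have "{1..Suc m} = insert (Suc m) {1..m}"
    by auto
  then show ?case
    using Suc by (auto simp: block_def)
qed simp

text \<open>Serves twice: it is the upper bound for the width, and with target exponents 2 and 1 it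
  yields the dual estimate \<open>inner_le_mixed_norm\<close>.\<close>

lemma mixed_norm_le:
  assumes "m \<ge> 1" "n \<ge> 1" "p1 \<in> {1..\<infinity>}" "p2 \<in> {1..\<infinity>}" "q1 \<in> {1..\<infinity>}" "q2 \<in> {1..\<infinity>}"
    "p1 \<le> q1" "q2 \<le> p2"
  shows "mixed_norm n m q1 q2 x
    \<le> real m powr (real_of_ereal (1 / q2) - real_of_ereal (1 / p2)) * mixed_norm n m p1 p2 x"
proof -
  have "mixed_norm n m q1 q2 x \<le> mixed_norm n m p1 q2 x"
    unfolding mixed_norm_def
  proof (rule lp_norm_mono)
    fix s assume "s \<in> {1..m}"
    then show "\<bar>lp_norm q1 (block n s) x\<bar> \<le> \<bar>lp_norm p1 (block n s) x\<bar>"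
      using assms by (simp add: lp_norm_nonneg lp_norm_antimono)
  qed (use assms in auto)
  also have "\<dots> \<le> real (card {1..m}) powr (real_of_ereal (1 / q2) - real_of_ereal (1 / p2)) * mixed_norm n m p1 p2 x"
    unfolding mixed_norm_def using assms by (intro lp_norm_le_card_powr_mult) auto
  finally show ?thesis
    by simp
qed

section \<open>Kolmogorov widths\<close>

lemma annihilator_vector_large_on_transversal:
  fixes A :: "(nat \<Rightarrow> real) set"
  assumes "finite A" "card A \<le> m * n div 2" "m \<ge> 1" "n \<ge> 1"
  obtains y i where "\<And>j. j \<notin> {1..m * n} \<Longrightarrow> y j = 0"
    "\<And>a. a \<in> A \<Longrightarrow> (\<Sum>j\<in>{1..m * n}. a j * y j) = 0"
    "\<And>s. s \<in> {1..m} \<Longrightarrow> (\<Sum>j\<in>block n s. (y j)\<^sup>2) \<le> 1"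
    "i \<in> Pi {1..m} (block n)" "(\<Sum>s\<in>{1..m}. (y (i s))\<^sup>2) \<ge> real m / 4608"
proof -
  define J where "J = {1..m * n}"
  have J: "(\<Union>s\<in>{1..m}. block n s) = J"
    using UN_block[OF assms(4)] by (simp add: J_def)
  define E where "E = {v. (\<forall>j. j \<notin> J \<longrightarrow> v j = 0) \<and> (\<forall>a\<in>A. (\<Sum>j\<in>J. a j * v j) = 0)}"
  define K where "K = {F. F \<subseteq> {1..m} \<and> 48 * card F \<le> card {1..m}}"
  define good where "good F j \<longleftrightarrow> (\<exists>v\<in>E. (\<forall>t\<in>F. \<forall>j\<in>block n t. v j = 0) \<and>
        v j = (\<Sum>i\<in>J. (v i)\<^sup>2) \<and> 1 / 4 \<le> v j \<and> v j \<le> 1)" for F j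
  have "\<forall>F\<in>K. \<exists>G. G \<subseteq> J \<and> real (card G) \<ge> 1 / 6 * real (m * n) \<and> (\<forall>j\<in>G. good F j)"
  proof
    fix F assume F: "F \<in> K"
    define U where "U = (\<Union>s\<in>F. block n s)"
    have finF: "finite F"
      using F by (auto simp: K_def intro: finite_subset)
    then have "finite U"
      by (simp add: U_def)
    moreover have "U \<subseteq> J"
      using F J by (auto simp: U_def K_def)
    ultimately have U: "U \<subseteq> J" "finite U"
      by auto
    have "card U \<le> (\<Sum>s\<in>F. card (block n s))"
      unfolding U_def by (rule card_UN_le[OF finF])
    also have "\<dots> = (\<Sum>s\<in>F. n)"
      using F by (intro sum.cong card_block) (auto simp: K_def)
    also have "\<dots> = card F * n"
      by simp
    finally have cardU: "card U \<le> card F * n" .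
    \<comment> \<open>These unit vectors, added to \<open>A\<close> as equations, force solutions to
      vanish on the blocks in \<open>F\<close>.\<close>
    define unit :: "nat \<Rightarrow> nat \<Rightarrow> real" where "unit j = (\<lambda>k. if k = j then 1 else 0)" for j
    have unit: "(\<Sum>k\<in>J. unit j k * v k) = v j" if "j \<in> J" for j v
    proof -
      have "(\<Sum>k\<in>J. unit j k * v k) = (\<Sum>k\<in>J. if k = j then v k else 0)"
        by (intro sum.cong) (auto simp: unit_def)
      then show ?thesis
        using that by (simp add: J_def)
    qed
    obtain G where G: "G \<subseteq> J" "real (card G) \<ge> (1 - 1 / 4) * card J - card (A \<union> unit ` U)"
      "\<And>j. j \<in> G \<Longrightarrow> \<exists>v. (\<forall>i. i \<notin> J \<longrightarrow> v i = 0) \<and>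
        (\<forall>a\<in>A \<union> unit ` U. (\<Sum>i\<in>J. a i * v i) = 0) \<and>
        v j = (\<Sum>i\<in>J. (v i)\<^sup>2) \<and> 1 / 4 \<le> v j \<and> v j \<le> 1"
      using many_large_projection_diagonal_entries[of "A \<union> unit ` U" J "1 / 4"] assms(1) U(2)
      by (auto simp: J_def)
    have "card (A \<union> unit ` U) \<le> m * n div 2 + card F * n"
      using card_Un_le[of A "unit ` U"] card_image_le[OF U(2), of unit] assms(2) cardU by linarith
    then have "real (card (A \<union> unit ` U)) \<le> real (m * n div 2 + card F * n)"
      by (simp only: of_nat_le_iff)
    moreover have "real (m * n div 2) \<le> real (m * n) / 2"
      by linarith
    moreover have "48 * (card F * n) \<le> m * n"
      using F by (simp add: K_def mult_le_mono1 flip: mult.assoc)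
    then have "48 * real (card F * n) \<le> real (m * n)"
      by (metis of_nat_le_iff of_nat_mult of_nat_numeral)
    moreover have "real (m * n) \<ge> 0"
      by simp
    \<comment> \<open>The proportion of good coordinates is at least
      \<open>3 / 4 - 1 / 2 - 1 / 48 = 11 / 48 \<ge> 1 / 6\<close>.\<close>
    ultimately have "real (card G) \<ge> 1 / 6 * real (m * n)"
      using G(2) by (simp add: J_def del: of_nat_mult)
    moreover have "good F j" if "j \<in> G" for j
    proof -
      from G(3)[OF that] obtain v where v: "\<forall>i. i \<notin> J \<longrightarrow> v i = 0"
        "\<forall>a\<in>A \<union> unit ` U. (\<Sum>i\<in>J. a i * v i) = 0"
        "v j = (\<Sum>i\<in>J. (v i)\<^sup>2)" "1 / 4 \<le> v j" "v j \<le> 1"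
        by blast
      have "v k = 0" if "k \<in> U" for k
        using v(2) unit[of k v] that U(1) by auto
      with v show ?thesis
        unfolding good_def by (intro bexI[of _ v]) (auto simp: E_def U_def)
    qed
    ultimately show "\<exists>G. G \<subseteq> J \<and> real (card G) \<ge> 1 / 6 * real (m * n) \<and> (\<forall>j\<in>G. good F j)"
      using G(1) by blast
  qed
  from bchoice[OF this] obtain G where G: "\<And>F. F \<in> K \<Longrightarrow> G F \<subseteq> J"
    "\<And>F. F \<in> K \<Longrightarrow> real (card (G F)) \<ge> 1 / 6 * real (m * n)"
    "\<And>F j. F \<in> K \<Longrightarrow> j \<in> G F \<Longrightarrow> good F j"
    by blast
  \<comment> \<open>The growth rate \<open>1 / 8\<close> of the number of small sets stays below the
    density \<open>1 / 6\<close>, as the union bound requires.\<close>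
  have "real (card K) \<le> exp (real m / 8)"
    unfolding K_def using card_small_subsets_le[of "{1..m}"] by simp
  also have "\<dots> < exp (1 / 6 * real (card {1..m}))"
    using assms(3) by simp
  finally have few: "real (card K) < exp (1 / 6 * real (card {1..m}))" .
  have "finite K"
    by (auto simp: K_def)
  have "\<exists>i. i \<in> Pi {1..m} (block n) \<and> (\<forall>F\<in>K. \<exists>s\<in>{1..m}. i s \<in> G F)"
    by (rule transversal_meeting_all[of "{1..m}" "block n" n K G "1 / 6"])
      (use assms few \<open>finite K\<close> G(1,2) J disjoint_family_block[OF assms(4), of m] in
        \<open>auto simp: card_block\<close>)
  then obtain i where i: "i \<in> Pi {1..m} (block n)" "\<And>F. F \<in> K \<Longrightarrow> \<exists>s\<in>{1..m}. i s \<in> G F"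
    by blast
  have escape: "\<exists>s\<in>{1..m}. \<exists>v\<in>E. (\<forall>t\<in>F. \<forall>j\<in>block n t. v j = 0) \<and>
      v (i s) = (\<Sum>j\<in>J. (v j)\<^sup>2) \<and> 1 / 4 \<le> v (i s) \<and> v (i s) \<le> 1"
    if "F \<subseteq> {1..m}" "48 * card F \<le> card {1..m}" for F
  proof -
    have "F \<in> K"
      using that by (simp add: K_def)
    with i(2) G(3) show ?thesis
      unfolding good_def by blast
  qed
  show thesis
  proof (rule extremal_vector_large_on_transversal[where S = "{1..m}" and D = "block n" and i = i
        and A = A, unfolded J, folded E_def])
    show "disjoint_family_on (block n) {1..m}"
      by (rule disjoint_family_block[OF assms(4)])
    fix y assume y: "y \<in> E" "\<And>s. s \<in> {1..m} \<Longrightarrow> (\<Sum>j\<in>block n s. (y j)\<^sup>2) \<le> 1"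
      "(\<Sum>s\<in>{1..m}. (y (i s))\<^sup>2) \<ge> real (card {1..m}) / 4608"
    show thesis
      by (rule that[of y i]) (use y i(1) in \<open>auto simp: E_def J_def\<close>)
  qed (simp, simp, rule i(1), rule escape)
qed

text \<open>Cauchy-Schwarz on each block bounds the pairing by the mixed norm with exponents 2 and
  1.\<close>

lemma inner_le_mixed_norm:
  assumes "m \<ge> 1" "n \<ge> 1" "q1 \<in> {1..\<infinity>}" "q2 \<in> {1..\<infinity>}" "q1 \<le> 2"
    and y: "\<And>s. s \<in> {1..m} \<Longrightarrow> (\<Sum>j\<in>block n s. (y j)\<^sup>2) \<le> 1"
  shows "(\<Sum>j\<in>{1..m * n}. w j * y j) \<le> real m powr (1 - real_of_ereal (1 / q2)) * mixed_norm n m q1 q2 w"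
proof -
  have "(\<Sum>j\<in>{1..m * n}. w j * y j) = (\<Sum>s\<in>{1..m}. \<Sum>j\<in>block n s. w j * y j)"
    unfolding UN_block[OF assms(2), symmetric] using disjoint_family_block[OF assms(2), of m]
    by (intro sum.UNION_disjoint) (auto simp: disjoint_family_on_def)
  also have "\<dots> \<le> (\<Sum>s\<in>{1..m}. \<bar>lp_norm 2 (block n s) w\<bar>)"
  proof (rule sum_mono)
    fix s assume s: "s \<in> {1..m}"
    have "(\<Sum>j\<in>block n s. w j * y j)\<^sup>2 \<le> (\<Sum>j\<in>block n s. (w j)\<^sup>2) * (\<Sum>j\<in>block n s. (y j)\<^sup>2)"
      by (rule Cauchy_Schwarz_ineq_sum)
    also have "\<dots> \<le> (\<Sum>j\<in>block n s. (w j)\<^sup>2) * 1"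
      using y[OF s] by (intro mult_left_mono sum_nonneg) auto
    finally have "(\<Sum>j\<in>block n s. w j * y j) \<le> lp_norm 2 (block n s) w"
      unfolding lp_norm_2 by (simp add: real_le_rsqrt)
    then show "(\<Sum>j\<in>block n s. w j * y j) \<le> \<bar>lp_norm 2 (block n s) w\<bar>"
      by linarith
  qed
  also have "\<dots> = mixed_norm n m 2 1 w"
    by (simp add: mixed_norm_def lp_norm_1)
  also have "\<dots> \<le> real m powr (real_of_ereal (1 / 1) - real_of_ereal (1 / q2)) * mixed_norm n m q1 q2 w"
    using assms by (intro mixed_norm_le) auto
  finally show ?thesis
    by (simp add: one_ereal_def)
qed

text \<open>Duality: \<open>y\<close> annihilates \<open>L\<close>, so \<open>x - z\<close> pairs
  with \<open>y\<close> as \<open>x\<close> does, and a large pairing forces a large norm.\<close>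

lemma exists_far_from_subspace:
  assumes "m \<ge> 1" "n \<ge> 1" "p1 \<in> {1..\<infinity>}" "p2 \<in> {1..\<infinity>}" "q1 \<in> {1..\<infinity>}" "q2 \<in> {1..\<infinity>}" "q1 \<le> 2"
    and L: "L = span B" "finite B" "dim L \<le> m * n div 2"
  shows "\<exists>x\<in>mixed_ball n m p1 p2. \<forall>z\<in>L.
    1 / 4608 * real m powr real_of_ereal (1 / q2 - 1 / p2) \<le> mixed_norm n m q1 q2 (x - z)"
proof -
  \<comment> \<open>A basis of \<open>L\<close> supplies at most \<open>m * n div 2\<close>
    equations; annihilating it annihilates \<open>L\<close>.\<close>
  obtain A where A: "A \<subseteq> L" "independent A" "L \<subseteq> span A" "card A = dim L"
    by (rule basis_exists)
  have "finite A"
    using A(1,2) L(1,2) independent_span_bound[of B A] by auto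
  then obtain y i where y: "\<And>j. j \<notin> {1..m * n} \<Longrightarrow> y j = 0"
    "\<And>a. a \<in> A \<Longrightarrow> (\<Sum>j\<in>{1..m * n}. a j * y j) = 0"
    "\<And>s. s \<in> {1..m} \<Longrightarrow> (\<Sum>j\<in>block n s. (y j)\<^sup>2) \<le> 1"
    and i: "i \<in> Pi {1..m} (block n)" "(\<Sum>s\<in>{1..m}. (y (i s))\<^sup>2) \<ge> real m / 4608"
    using annihilator_vector_large_on_transversal[of A m n] A(4) L(3) assms(1,2) by auto
  have ortho: "(\<Sum>j\<in>{1..m * n}. z j * y j) = 0" if "z \<in> L" for z
  proof -
    have "subspace {z. (\<Sum>j\<in>{1..m * n}. z j * y j) = 0}"
      by (auto simp: subspace_def scaleR_fun_def distrib_right sum.distrib mult.assoc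
          simp flip: sum_distrib_left)
    then have "span A \<subseteq> {z. (\<Sum>j\<in>{1..m * n}. z j * y j) = 0}"
      using y(2) by (intro span_minimal) auto
    then show ?thesis
      using that A(3) by blast
  qed
  \<comment> \<open>\<open>h\<close> is the constant value of \<open>m\<close> block norms whose
    outer norm is 1. With one nonzero entry per block, the inner norm of \<open>x\<close> is
    \<open>h\<close> for every \<open>p1\<close>.\<close>
  define h where "h = real m powr - real_of_ereal (1 / p2)"
  define x where "x j = (if \<exists>s\<in>{1..m}. j = i s then h * (if y j \<ge> 0 then 1 else - 1) else 0)" for j
  have h: "h \<ge> 0"
    by (simp add: h_def)
  have ib: "i s \<in> block n s" if "s \<in> {1..m}" for s
    using i(1) that by auto
  have xb: "x j = (if j = i s then h * (if y (i s) \<ge> 0 then 1 else - 1) else 0)"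
    if s: "s \<in> {1..m}" and j: "j \<in> block n s" for s j
  proof -
    have "t = s" if t: "t \<in> {1..m}" "j = i t" for t
    proof -
      have "s = (j - 1) div n + 1"
        using mem_block_iff[of n s j] s j assms(2) by simp
      moreover have "t = (j - 1) div n + 1"
        using mem_block_iff[of n t j] t ib[OF t(1)] assms(2) by simp
      ultimately show ?thesis
        by simp
    qed
    then have "(\<exists>t\<in>{1..m}. j = i t) \<longleftrightarrow> j = i s"
      using s by metis
    then show ?thesis
      unfolding x_def by simp
  qed
  have "x j = 0" if "j \<notin> {1..m * n}" for j
  proof -
    have "j \<notin> block n s" if "s \<in> {1..m}" for s
      using \<open>j \<notin> {1..m * n}\<close> UN_block[OF assms(2), of m] that by blast
    then have "\<not> (\<exists>s\<in>{1..m}. j = i s)"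
      using ib by blast
    then show ?thesis
      by (simp add: x_def)
  qed
  then have "x \<in> Rvec (m * n)"
    by (simp add: Rvec_def)
  moreover have "mixed_norm n m p1 p2 x = 1"
  proof -
    have "lp_norm p1 (block n s) x = h" if s: "s \<in> {1..m}" for s
    proof -
      have "lp_norm p1 (block n s) x
          = lp_norm p1 (block n s) (\<lambda>j. if j = i s then h * (if y (i s) \<ge> 0 then 1 else - 1) else 0)"
        using xb[OF s] by (intro lp_norm_cong) auto
      then show ?thesis
        using h ib[OF s] assms(3) by (simp add: lp_norm_single)
    qed
    then have "mixed_norm n m p1 p2 x = lp_norm p2 {1..m} (\<lambda>_. h)"
      unfolding mixed_norm_def by (intro lp_norm_cong) auto
    also have "\<dots> = h * real m powr real_of_ereal (1 / p2)"
      using assms h lp_norm_const[of p2 "{1..m}" h] by simp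
    also have "\<dots> = 1"
      using assms(1) by (simp add: h_def powr_minus field_simps)
    finally show ?thesis .
  qed
  ultimately have xball: "x \<in> mixed_ball n m p1 p2"
    by (simp add: mixed_ball_def)
  have xy: "h * (real m / 4608) \<le> (\<Sum>j\<in>{1..m * n}. x j * y j)"
  proof -
    have "h * (real m / 4608) \<le> h * (\<Sum>s\<in>{1..m}. (y (i s))\<^sup>2)"
      using i(2) h by (rule mult_left_mono)
    \<comment> \<open>Coordinates of \<open>y\<close> are at most 1 in modulus, so squares are
      dominated by absolute values, which the signs in \<open>x\<close> produce.\<close>
    also have "\<dots> \<le> h * (\<Sum>s\<in>{1..m}. \<bar>y (i s)\<bar>)"
    proof (intro mult_left_mono sum_mono h)
      fix s assume s: "s \<in> {1..m}"
      have "(y (i s))\<^sup>2 \<le> (\<Sum>j\<in>block n s. (y j)\<^sup>2)"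
        using ib[OF s] by (intro member_le_sum) auto
      also have "\<dots> \<le> 1"
        by (rule y(3)[OF s])
      finally have "\<bar>y (i s)\<bar> \<le> 1"
        by (simp add: abs_square_le_1)
      then show "(y (i s))\<^sup>2 \<le> \<bar>y (i s)\<bar>"
        using mult_left_mono[of "\<bar>y (i s)\<bar>" 1 "\<bar>y (i s)\<bar>"] by (simp add: power2_eq_square)
    qed
    also have "\<dots> = (\<Sum>s\<in>{1..m}. \<Sum>j\<in>block n s. x j * y j)"
      unfolding sum_distrib_left
    proof (rule sum.cong)
      fix s assume s: "s \<in> {1..m}"
      have "(\<Sum>j\<in>block n s. x j * y j) = (\<Sum>j\<in>block n s. if j = i s then h * \<bar>y (i s)\<bar> else 0)"
        using xb[OF s] by (intro sum.cong) (auto simp: abs_if)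
      then show "h * \<bar>y (i s)\<bar> = (\<Sum>j\<in>block n s. x j * y j)"
        using ib[OF s] by simp
    qed simp
    also have "\<dots> = (\<Sum>j\<in>{1..m * n}. x j * y j)"
      unfolding UN_block[OF assms(2), symmetric] using disjoint_family_block[OF assms(2), of m]
      by (intro sum.UNION_disjoint[symmetric]) (auto simp: disjoint_family_on_def)
    finally show ?thesis .
  qed
  have "1 / 4608 * real m powr real_of_ereal (1 / q2 - 1 / p2) \<le> mixed_norm n m q1 q2 (x - z)"
    if z: "z \<in> L" for z
  proof -
    have "h * (real m / 4608) \<le> (\<Sum>j\<in>{1..m * n}. (x - z) j * y j)"
      using xy ortho[OF z] by (simp add: left_diff_distrib sum_subtractf)
    also have "\<dots> \<le> real m powr (1 - real_of_ereal (1 / q2)) * mixed_norm n m q1 q2 (x - z)"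
      using assms y(3) by (intro inner_le_mixed_norm) auto
    finally have "h * (real m / 4608) / real m powr (1 - real_of_ereal (1 / q2)) \<le> mixed_norm n m q1 q2 (x - z)"
      using assms(1) by (simp add: field_simps)
    \<comment> \<open>The powers of \<open>m\<close> combine as
      \<open>- 1 / p2 + 1 - (1 - 1 / q2) = 1 / q2 - 1 / p2\<close>.\<close>
    moreover have "h * (real m / 4608) / real m powr (1 - real_of_ereal (1 / q2))
        = 1 / 4608 * real m powr real_of_ereal (1 / q2 - 1 / p2)"
      using assms unfolding real_of_ereal_inverse_diff[OF assms(4,6)] h_def
      by (simp add: powr_diff powr_minus field_simps)
    ultimately show ?thesis
      by simp
  qed
  with xball show ?thesis
    by blast
qed

theorem mainTheorem4:
  shows "\<exists>c::real. c > 0 \<and>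
    (\<forall>(m::nat) (n::nat) (p1::ereal) (p2::ereal) (q1::ereal) (q2::ereal).
       m \<ge> 1 \<longrightarrow> n \<ge> 1 \<longrightarrow>
       p1 \<in> {1..\<infinity>} \<longrightarrow> p2 \<in> {1..\<infinity>} \<longrightarrow> q1 \<in> {1..\<infinity>} \<longrightarrow> q2 \<in> {1..\<infinity>} \<longrightarrow>
       p1 \<le> q1 \<longrightarrow> q1 \<le> 2 \<longrightarrow> p2 \<ge> q2 \<longrightarrow>
       ereal (c * real m powr real_of_ereal (1 / q2 - 1 / p2))
         \<le> kolmogorov_width (m * n div 2) (mixed_ball n m p1 p2)
             (Rvec (m * n)) (mixed_norm n m q1 q2) \<and>
       kolmogorov_width (m * n div 2) (mixed_ball n m p1 p2)
           (Rvec (m * n)) (mixed_norm n m q1 q2)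
         \<le> ereal (real m powr real_of_ereal (1 / q2 - 1 / p2)))"
proof (intro exI[of _ "1 / 4608"] conjI allI impI)
  fix m n :: nat and p1 p2 q1 q2 :: ereal
  assume mn: "1 \<le> m" "1 \<le> n"
    and p: "p1 \<in> {1..\<infinity>}" "p2 \<in> {1..\<infinity>}" and q: "q1 \<in> {1..\<infinity>}" "q2 \<in> {1..\<infinity>}"
    and le: "p1 \<le> q1" "q1 \<le> 2" "q2 \<le> p2"
  define M where "M = real m powr real_of_ereal (1 / q2 - 1 / p2)"
  show "ereal (1 / 4608 * real m powr real_of_ereal (1 / q2 - 1 / p2))
      \<le> kolmogorov_width (m * n div 2) (mixed_ball n m p1 p2) (Rvec (m * n)) (mixed_norm n m q1 q2)"
    unfolding kolmogorov_width_def M_def[symmetric]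
  proof (rule INF_greatest)
    fix L assume "L \<in> {L. subspace L \<and> L \<subseteq> Rvec (m * n) \<and> (\<exists>B. finite B \<and> L = span B) \<and> dim L \<le> m * n div 2}"
    then obtain B where "L = span B" "finite B" "dim L \<le> m * n div 2"
      by blast
    \<comment> \<open>The point \<open>x\<close> may depend on \<open>L\<close>, since the supremum
      over the ball is taken for each subspace separately.\<close>
    from exists_far_from_subspace[OF mn p q le(2) this]
    obtain x where x: "x \<in> mixed_ball n m p1 p2"
      "\<And>z. z \<in> L \<Longrightarrow> 1 / 4608 * M \<le> mixed_norm n m q1 q2 (x - z)"
      unfolding M_def by blast
    from x(1) show "ereal (1 / 4608 * M)
      \<le> (SUP x\<in>mixed_ball n m p1 p2. INF y\<in>L. ereal (mixed_norm n m q1 q2 (x - y)))"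
      by (rule SUP_upper2) (use x(2) in \<open>auto intro!: INF_greatest\<close>)
  qed
  show "kolmogorov_width (m * n div 2) (mixed_ball n m p1 p2) (Rvec (m * n)) (mixed_norm n m q1 q2)
      \<le> ereal (real m powr real_of_ereal (1 / q2 - 1 / p2))"
    unfolding kolmogorov_width_def M_def[symmetric]
  proof (rule INF_lower2)
    show "{0} \<in> {L. subspace L \<and> L \<subseteq> Rvec (m * n) \<and> (\<exists>B. finite B \<and> L = span B) \<and> dim L \<le> m * n div 2}"
    proof -
      have "{0} = span ({} :: (nat \<Rightarrow> real) set)"
        by simp
      moreover have "dim {0 :: nat \<Rightarrow> real} = 0"
        by (metis calculation dim_span card.empty dim_eq_card_independent independent_empty)
      ultimately show ?thesis
        by (auto simp: Rvec_def intro!: exI[of _ "{}"])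
    qed
    show "(SUP x\<in>mixed_ball n m p1 p2. INF y\<in>{0}. ereal (mixed_norm n m q1 q2 (x - y))) \<le> ereal M"
    proof (rule SUP_least)
      fix x assume "x \<in> mixed_ball n m p1 p2"
      then have "mixed_norm n m p1 p2 x \<le> 1"
        by (simp add: mixed_ball_def)
      then have "M * mixed_norm n m p1 p2 x \<le> M * 1"
        by (intro mult_left_mono) (auto simp: M_def)
      then have "mixed_norm n m q1 q2 x \<le> M"
        using mixed_norm_le[OF mn p q le(1,3), of x]
        unfolding M_def real_of_ereal_inverse_diff[OF p(2) q(2)] by simp
      then show "(INF y\<in>{0}. ereal (mixed_norm n m q1 q2 (x - y))) \<le> ereal M"
        by simp
    qed
  qed
qed simp

end
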